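(* Let $K=2$ and let $x=(\{a_{\ell,j}\},\{z_j\})\in\mathbb{C}^R$, with $|z_1|=|z_2|=1$, be a regular point of the polynomial Prony map $\mathcal{P}_{0,1}^{(P)}$. Then there exists a constant $C_3=C_3(x)>0$ such that for any $M\in\mathbb{N}$ there exists an integer $p=p(M,x)>M$ for which $$\rho(x,z_j,p)\ge C_3\,p^{\ell_j},\qquad j=1,2.$$
   Context: Let $K=2$, let $\ell_1,\ell_2\ge1$ be integers, and $R=(\ell_1+1)+(\ell_2+1)$. The unknowns are $z_j$ and $a_{\ell,j}\in\mathbb{C}$ ($j=1,2$, $0\le\ell\le\ell_j-1$). The polynomial Prony map is $\mathcal{P}_{0,1}^{(P)}(\{z_j\},\{a_{\ell,j}\})=(m_0,m_1,\dots,m_{R-1})$ with $m_k=\sum_{j=1}^{2}z_j^k\sum_{\ell=0}^{\ell_j-1}a_{\ell,j}k^\ell$ (with $0^0=1$). A point is regular if the Jacobian matrix of the map at it is invertible (in particular $z_1\ne z_2$). For an integer $p\ge1$ put $\delta_p=|z_1^p-z_2^p|$ and $\delta=\delta_1$. The improvement function is $$\rho(x,z_j,p)=\left(\frac{\delta_p}{\delta}\right)^{R}p^{\ell_j}.$$ *)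

theory Defs
  imports "HOL-Analysis.Analysis" "Jordan_Normal_Form.Matrix"
begin

unbundle no vec_syntax

hide_const (open) Finite_Cartesian_Product.vec Finite_Cartesian_Product.mat

text \<open>
  The nodes are indexed by \<open>j \<in> {1, 2}\<close>, and \<open>l 1\<close>, \<open>l 2\<close> are the multiplicities.
  A point of the parameter space is the vector of length \<open>R = (l 1 + 1) + (l 2 + 1)\<close>
  with entries
  \<open>(z\<^sub>1, z\<^sub>2, a\<^bsub>0,1\<^esub>, \<dots>, a\<^bsub>l 1 - 1,1\<^esub>, a\<^bsub>0,2\<^esub>, \<dots>, a\<^bsub>l 2 - 1,2\<^esub>)\<close>.
\<close>

definition prony_dim :: "(nat \<Rightarrow> nat) \<Rightarrow> nat" where
  "prony_dim l = (l 1 + 1) + (l 2 + 1)"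

definition prony_node :: "complex vec \<Rightarrow> nat \<Rightarrow> complex" where
  "prony_node x j = x $ (j - 1)"

definition prony_coeff :: "(nat \<Rightarrow> nat) \<Rightarrow> complex vec \<Rightarrow> nat \<Rightarrow> nat \<Rightarrow> complex" where
  "prony_coeff l x i j = x $ (2 + (if j = 1 then 0 else l 1) + i)"

definition prony_moment :: "(nat \<Rightarrow> nat) \<Rightarrow> complex vec \<Rightarrow> nat \<Rightarrow> complex" where
  "prony_moment l x k =
     (\<Sum>j\<in>{1, 2}. prony_node x j ^ k * (\<Sum>i<l j. prony_coeff l x i j * of_nat k ^ i))"

definition prony_map :: "(nat \<Rightarrow> nat) \<Rightarrow> complex vec \<Rightarrow> complex vec" where
  "prony_map l x = vec (prony_dim l) (prony_moment l x)"

text \<open>The entry \<open>(k, c)\<close> is the complex partial derivative of the \<open>k\<close>-th component with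
  respect to the \<open>c\<close>-th coordinate; both indices start at \<open>0\<close>.\<close>

definition prony_jacobian :: "(nat \<Rightarrow> nat) \<Rightarrow> complex vec \<Rightarrow> complex mat" where
  "prony_jacobian l x = mat (prony_dim l) (prony_dim l)
     (\<lambda>(k, c). deriv (\<lambda>t. prony_map l (update_vec x c t) $ k) (x $ c))"

definition prony_regular :: "(nat \<Rightarrow> nat) \<Rightarrow> complex vec \<Rightarrow> bool" where
  "prony_regular l x \<longleftrightarrow> x \<in> carrier_vec (prony_dim l) \<and> invertible_mat (prony_jacobian l x)"

definition node_separation :: "complex vec \<Rightarrow> nat \<Rightarrow> real" where
  "node_separation x p = cmod (prony_node x 1 ^ p - prony_node x 2 ^ p)"

definition improvement :: "(nat \<Rightarrow> nat) \<Rightarrow> complex vec \<Rightarrow> nat \<Rightarrow> nat \<Rightarrow> real" where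
  "improvement l x j p =
     (node_separation x p / node_separation x 1) ^ prony_dim l * real p ^ l j"

end

theory Submission
  imports Defs
begin

text \<open>If the nodes coincided, the partial derivatives of the moments with respect to
  \<open>a\<^bsub>0,1\<^esub>\<close> and \<open>a\<^bsub>0,2\<^esub>\<close> would be equal columns of the Jacobian; so regularity gives
  \<open>\<delta> > 0\<close>. On the unit circle
  \<open>z\<^sub>1 ^ (p + 1) - z\<^sub>2 ^ (p + 1) = z\<^sub>1 * (z\<^sub>1 ^ p - z\<^sub>2 ^ p) + z\<^sub>2 ^ p * (z\<^sub>1 - z\<^sub>2)\<close>
  shows that of any two consecutive exponents one has separation at least \<open>\<delta> / 2\<close>, so
  \<open>C\<^sub>3 = (1/2) ^ R\<close> works.\<close>

text \<open>For a left inverse \<open>B\<close>, the entries \<open>(c, c)\<close> and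
  \<open>(c, d)\<close> of \<open>B * A\<close> pair the same row of \<open>B\<close> with columns
  \<open>c\<close> and \<open>d\<close> of \<open>A\<close>. Equal columns would force 1 =
  0.\<close>

lemma invertible_mat_cols_distinct:
  fixes A :: "'a :: semiring_1 mat"
  assumes "invertible_mat A" and "c < dim_col A" and "d < dim_col A" and "c \<noteq> d"
  shows "col A c \<noteq> col A d"
proof
  assume eq: "col A c = col A d"
  obtain B where sq: "dim_row A = dim_col A" and BA: "B * A = 1\<^sub>m (dim_row B)"
    using assms(1) by (auto simp: invertible_mat_def inverts_mat_def)
  have dim: "dim_row B = dim_col A"
    using BA by (metis index_mult_mat(3) index_one_mat(3))
  have "(B * A) $$ (c, c) = (B * A) $$ (c, d)"
    using eq assms dim by simp
  then show False
    using BA assms dim by simp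
qed

lemma prony_node_update_coeff:
  assumes "j \<in> {1, 2}"
  shows "prony_node (update_vec x (2 + c) t) j = prony_node x j"
  using assms by (auto simp: prony_node_def)

text \<open>Position \<open>c\<close> holds the constant coefficient of node \<open>r\<close>, and
  for \<open>i < l j\<close> the two coefficient blocks do not overlap. Writing the change as an
  increment prepares the affine dependence of the moments on \<open>t\<close>.\<close>

lemma prony_coeff_update_constant:
  assumes "1 \<le> l 1" and "x \<in> carrier_vec (prony_dim l)" and "1 \<le> l 2"
    and "r \<in> {1, 2}" and "j \<in> {1, 2}" and "i < l j"
  defines "c \<equiv> 2 + (if r = 1 then 0 else l 1)"
  shows "prony_coeff l (update_vec x c t) i j =
    prony_coeff l x i j + (if j = r \<and> i = 0 then t - x $ c else 0)"
  using assms by (auto simp: prony_coeff_def update_vec_def prony_dim_def)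

lemma prony_moment_update_constant:
  assumes "1 \<le> l 1" and "1 \<le> l 2" and "x \<in> carrier_vec (prony_dim l)" and "r \<in> {1, 2}"
  defines "c \<equiv> 2 + (if r = 1 then 0 else l 1)"
  shows "prony_moment l (update_vec x c t) k =
    prony_moment l x k + prony_node x r ^ k * (t - x $ c)"
proof -
  have inner: "(\<Sum>i<l j. prony_coeff l (update_vec x c t) i j * of_nat k ^ i) =
      (\<Sum>i<l j. prony_coeff l x i j * of_nat k ^ i) + (if j = r then t - x $ c else 0)"
    if j: "j \<in> {1, 2}" for j
  proof -
    \<comment> \<open>The increment sits at \<open>i = 0\<close>, where its factor
      \<open>of_nat k ^ 0\<close> is 1 even for \<open>k = 0\<close>.\<close>
    have "(\<Sum>i<l j. prony_coeff l (update_vec x c t) i j * of_nat k ^ i) =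
        (\<Sum>i<l j. prony_coeff l x i j * of_nat k ^ i
          + (if i = 0 then if j = r then t - x $ c else 0 else 0))"
      using assms j prony_coeff_update_constant[of l x r j]
      by (intro sum.cong) (auto simp: algebra_simps)
    also have "\<dots> = (\<Sum>i<l j. prony_coeff l x i j * of_nat k ^ i)
        + (if j = r then t - x $ c else 0)"
      using assms j by (auto simp: sum.distrib)
    finally show ?thesis .
  qed
  have "prony_moment l (update_vec x c t) k =
      (\<Sum>j\<in>{1, 2}. prony_node x j ^ k * (\<Sum>i<l j. prony_coeff l x i j * of_nat k ^ i)
        + (if j = r then prony_node x r ^ k * (t - x $ c) else 0))"
    unfolding prony_moment_def
    using inner prony_node_update_coeff[of _ x _ t]
    by (intro sum.cong) (auto simp: c_def algebra_simps)
  also have "\<dots> = prony_moment l x k + prony_node x r ^ k * (t - x $ c)"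
    using assms(4) by (auto simp: prony_moment_def)
  finally show ?thesis .
qed

text \<open>Each moment is affine in the constant coefficient of node \<open>r\<close>, with slope
  the \<open>k\<close>-th power of that node. The column is thus a Vandermonde column depending on
  the node alone.\<close>

lemma prony_jacobian_constant_coeff:
  assumes "1 \<le> l 1" and "1 \<le> l 2" and "x \<in> carrier_vec (prony_dim l)" and "r \<in> {1, 2}"
    and "k < prony_dim l"
  defines "c \<equiv> 2 + (if r = 1 then 0 else l 1)"
  shows "prony_jacobian l x $$ (k, c) = prony_node x r ^ k"
proof -
  have "c < prony_dim l"
    using assms by (auto simp: prony_dim_def)
  moreover have "deriv (\<lambda>t. prony_moment l x k + prony_node x r ^ k * (t - x $ c)) (x $ c) =
      prony_node x r ^ k"
    by (rule DERIV_imp_deriv) (auto intro!: derivative_eq_intros)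
  ultimately show ?thesis
    using assms prony_moment_update_constant[of l x r]
    by (simp add: prony_jacobian_def prony_map_def)
qed

lemma prony_regular_nodes_distinct:
  assumes "1 \<le> l 1" and "1 \<le> l 2" and "prony_regular l x"
  shows "prony_node x 1 \<noteq> prony_node x 2"
proof
  assume eq: "prony_node x 1 = prony_node x 2"
  have x: "x \<in> carrier_vec (prony_dim l)" and inv: "invertible_mat (prony_jacobian l x)"
    using assms by (auto simp: prony_regular_def)
  have "col (prony_jacobian l x) 2 = col (prony_jacobian l x) (2 + l 1)"
    using prony_jacobian_constant_coeff[OF assms(1,2) x, of 1]
      prony_jacobian_constant_coeff[OF assms(1,2) x, of 2] eq assms(1,2)
    by (intro eq_vecI) (auto simp: prony_jacobian_def prony_dim_def)
  \<comment> \<open>The two indices differ because \<open>l 1\<close> is positive.\<close>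
  moreover have "col (prony_jacobian l x) 2 \<noteq> col (prony_jacobian l x) (2 + l 1)"
    using assms by (intro invertible_mat_cols_distinct[OF inv])
      (auto simp: prony_jacobian_def prony_dim_def)
  ultimately show False
    by contradiction
qed

lemma norm_diff_le_consecutive_powers:
  fixes z w :: "'a :: {real_normed_div_algebra, comm_ring_1}"
  assumes "norm z = 1" and "norm w = 1"
  shows "norm (z - w) \<le> norm (z ^ p - w ^ p) + norm (z ^ Suc p - w ^ Suc p)"
proof -
  have "norm (z - w) = norm (w ^ p * (z - w))"
    using assms by (simp add: norm_mult norm_power)
  \<comment> \<open>Multiplying by the unimodular \<open>w ^ p\<close> keeps the norm and brings in
    the differences of consecutive powers.\<close>
  also have "w ^ p * (z - w) = (z ^ Suc p - w ^ Suc p) - z * (z ^ p - w ^ p)"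
    by (simp add: algebra_simps)
  also have "norm \<dots> \<le> norm (z ^ Suc p - w ^ Suc p) + norm (z * (z ^ p - w ^ p))"
    by (rule norm_triangle_ineq4)
  also have "norm (z * (z ^ p - w ^ p)) = norm (z ^ p - w ^ p)"
    using assms by (simp add: norm_mult)
  finally show ?thesis
    by simp
qed

theorem corollary2p15:
  fixes l :: "nat \<Rightarrow> nat" and x :: "complex vec"
  assumes "1 \<le> l 1" and "1 \<le> l 2"
    and "x \<in> carrier_vec (prony_dim l)"
    and "cmod (prony_node x 1) = 1" and "cmod (prony_node x 2) = 1"
    and "prony_regular l x"
  shows "\<exists>C\<^sub>3::real. C\<^sub>3 > 0 \<and>
    (\<forall>M::nat. \<exists>p::nat. p > M \<and>
      (\<forall>j\<in>{1, 2}. improvement l x j p \<ge> C\<^sub>3 * real p ^ l j))"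
proof (intro exI[of _ "(1 / 2) ^ prony_dim l"] conjI allI)
  fix M :: nat
  have pos: "node_separation x 1 > 0"
    using prony_regular_nodes_distinct[OF assms(1,2,6)] by (simp add: node_separation_def)
  \<comment> \<open>Starting at \<open>Suc M\<close> makes both candidate exponents exceed
    \<open>M\<close>.\<close>
  have "node_separation x 1 \<le> node_separation x (Suc M) + node_separation x (Suc (Suc M))"
    using norm_diff_le_consecutive_powers[OF assms(4,5), of "Suc M"]
    by (simp add: node_separation_def)
  then have "node_separation x 1 / 2 \<le> node_separation x (Suc M) \<or>
      node_separation x 1 / 2 \<le> node_separation x (Suc (Suc M))"
    by linarith
  then obtain p where p: "p > M" "node_separation x 1 / 2 \<le> node_separation x p"
    by (metis lessI less_SucI)
  have "1 / 2 \<le> node_separation x p / node_separation x 1"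
    using p pos by (simp add: field_simps)
  \<comment> \<open>The choice of \<open>p\<close> does not involve \<open>j\<close>, so one
    exponent serves both nodes.\<close>
  then have "improvement l x j p \<ge> (1 / 2) ^ prony_dim l * real p ^ l j" for j
    unfolding improvement_def by (intro mult_right_mono power_mono) auto
  with p(1) show "\<exists>p>M. \<forall>j\<in>{1, 2}. improvement l x j p \<ge> (1 / 2) ^ prony_dim l * real p ^ l j"
    by blast
qed simp

end
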